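(* Let $G$ be a finite connected simple graph on vertex set $\{1,\dots,n\}$ with maximum degree $\Delta$. Suppose a terminating chip-firing game with $N$ chips was played on $G$, let $x_i$ be the number of times vertex $i$ fired and $s=\sum_{i=1}^n x_i$ the total number of firings. Let $k$ be a vertex with $x_k=0$. Then $$ s \leq n\Big(f(\Delta-1) + o(2N-\Delta+1)\Big),$$ where $f=\max_{1\le i\le n} L^{\dagger}_{ii}$ and $o=\max_{i\neq j}|L^{\dagger}_{ij}|$.
   Context: Chip-firing game: a configuration is a vector $\mathbf a\in\mathbb Z_{\ge 0}^n$ ($a_i$ chips on vertex $i$), with $N=\sum_i a_i$ chips. Vertex $i$ of degree $d_i$ may fire if $a_i\ge d_i$; firing moves one chip from $i$ to each neighbour of $i$. A terminating game is a finite sequence of legal firings starting from an initial configuration $\mathbf a$ and ending in a configuration $\mathbf b$ in which no vertex can fire. $L$ is the Laplacian of $G$ ($L_{ii}=d_i$, $L_{ij}=-1$ for adjacent $i\neq j$, $0$ otherwise) and $L^{\dagger}$ its Moore–Penrose pseudo-inverse (the unique $X$ with $LXL=L$, $XLX=X$, $LX$ and $XL$ symmetric). *)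

theory Defs
  imports "HOL-Analysis.Analysis" "Graph_Theory.Digraph_Component"
begin

text \<open>
  Graphs are those of the AFP entry on graph theory: \<^locale>\<open>graph\<close> is a finite symmetric digraph
  without loops or parallel arcs, so an edge is a pair of opposite arcs and the degree of a vertex
  is its \<^const>\<open>out_degree\<close>. Both \<^theory>\<open>HOL-Analysis.Connected\<close> and the graph entry have a constant
  \<open>connected\<close>, so the latter is referred to by its qualified name.

  The vertices are the elements of a finite type \<open>'n\<close>, which also indexes the matrices.
\<close>

definition max_degree :: "('n::finite, 'e) pre_digraph \<Rightarrow> nat" where
  "max_degree G = Max (out_degree G ` verts G)"

definition laplacian :: "('n::finite, 'e) pre_digraph \<Rightarrow> real ^ 'n ^ 'n" where
  "laplacian G = (\<chi> i j. if i = j then real (out_degree G i)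
                         else if i \<rightarrow>\<^bsub>G\<^esub> j then - 1 else 0)"

subsection \<open>Moore--Penrose pseudo-inverse\<close>

definition is_pinv :: "real ^ 'n ^ 'm \<Rightarrow> real ^ 'm ^ 'n \<Rightarrow> bool" where
  "is_pinv A X \<longleftrightarrow> A ** X ** A = A \<and> X ** A ** X = X \<and>
     transpose (A ** X) = A ** X \<and> transpose (X ** A) = X ** A"

definition pinv :: "real ^ 'n ^ 'm \<Rightarrow> real ^ 'm ^ 'n" where
  "pinv A = (THE X. is_pinv A X)"

lemma is_pinv_unique:
  assumes X: "is_pinv A X" and Y: "is_pinv A Y"
  shows "X = Y"
proof -
  have "A ** X = transpose ((A ** Y) ** (A ** X))"
    using X Y by (simp add: is_pinv_def matrix_mul_assoc)
  also have "\<dots> = (A ** X) ** (A ** Y)"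
    using X Y by (simp add: is_pinv_def matrix_transpose_mul)
  finally have AX: "A ** X = A ** Y"
    using X by (simp add: is_pinv_def matrix_mul_assoc)
  have "X ** A = transpose ((X ** A) ** (Y ** A))"
    using X Y by (simp add: is_pinv_def flip: matrix_mul_assoc)
  also have "\<dots> = (Y ** A) ** (X ** A)"
    using X Y by (simp add: is_pinv_def matrix_transpose_mul)
  finally have XA: "X ** A = Y ** A"
    using X by (simp add: is_pinv_def flip: matrix_mul_assoc)
  have "X = X ** A ** X" using X by (simp add: is_pinv_def)
  also have "\<dots> = Y ** A ** Y" using AX XA by (simp flip: matrix_mul_assoc)
  finally show ?thesis using Y by (simp add: is_pinv_def)
qed

lemma pinv_eqI: "is_pinv A X \<Longrightarrow> pinv A = X"
  unfolding pinv_def by (blast intro: the_equality is_pinv_unique)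

subsection \<open>The chip-firing game\<close>

type_synonym 'n config = "'n \<Rightarrow> nat"

text \<open>The natural-number subtraction is exact whenever the firing of \<open>i\<close> is legal.\<close>

definition fire :: "('n, 'e) pre_digraph \<Rightarrow> 'n \<Rightarrow> 'n config \<Rightarrow> 'n config" where
  "fire G i a = (\<lambda>j. if j = i then a j - out_degree G i
                     else if i \<rightarrow>\<^bsub>G\<^esub> j then a j + 1 else a j)"

definition can_fire :: "('n, 'e) pre_digraph \<Rightarrow> 'n config \<Rightarrow> 'n \<Rightarrow> bool" where
  "can_fire G a i \<longleftrightarrow> i \<in> verts G \<and> out_degree G i \<le> a i"

text \<open>\<open>game G a vs b\<close>: firing the vertices of the list \<open>vs\<close> one after another is legal and leads
  from \<open>a\<close> to \<open>b\<close>.\<close>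

inductive game :: "('n, 'e) pre_digraph \<Rightarrow> 'n config \<Rightarrow> 'n list \<Rightarrow> 'n config \<Rightarrow> bool"
  for G where
  Nil: "game G a [] a"
| Cons: "can_fire G a i \<Longrightarrow> game G (fire G i a) vs b \<Longrightarrow> game G a (i # vs) b"

definition terminating_game ::
    "('n, 'e) pre_digraph \<Rightarrow> 'n config \<Rightarrow> 'n list \<Rightarrow> 'n config \<Rightarrow> bool" where
  "terminating_game G a vs b \<longleftrightarrow> game G a vs b \<and> (\<forall>i. \<not> can_fire G b i)"

end

theory Submission
  imports Defs
begin

text \<open>
  Let \<open>P\<close> be the matrix with all entries \<open>1/n\<close>. Since \<open>G\<close> is connected, \<open>L + P\<close> is invertible,
  \<open>X = (L + P)\<^sup>-\<^sup>1 - P\<close> is the pseudo-inverse of \<open>L\<close>, and \<open>X L = 1 - P\<close>. From \<open>b = a - L x\<close> we get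
  \<open>X (b - a) = P x - x\<close>, whose entry at \<open>k\<close> is \<open>s / n\<close> because \<open>x k = 0\<close>. It remains to bound
  \<open>\<Sum>\<^sub>j X\<^sub>k\<^sub>j (b\<^sub>j - a\<^sub>j)\<close>. The diagonal term is at most \<open>f b\<^sub>k\<close> and the others sum to at most
  \<open>off (2 N - b\<^sub>k)\<close>. As \<open>X\<close> is positive semidefinite, \<open>off \<le> f\<close>, so \<open>b\<^sub>k\<close> may be
  replaced by its upper bound \<open>\<Delta> - 1\<close>.
\<close>

section \<open>The Laplacian: action, quadratic form and kernel\<close>

lemma out_degree_eq_card:
  fixes G :: "('n::finite, 'e) pre_digraph"
  assumes "graph G"
  shows "out_degree G i = card {j. i \<rightarrow>\<^bsub>G\<^esub> j}"
proof -
  interpret graph G by fact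
  \<comment> \<open>Without parallel arcs, an arc leaving \<open>i\<close> is determined by its
    head.\<close>
  have "bij_betw (head G) (out_arcs G i) {j. i \<rightarrow>\<^bsub>G\<^esub> j}"
    unfolding bij_betw_def
  proof
    show "inj_on (head G) (out_arcs G i)"
      by (rule inj_onI) (auto intro!: no_multi_arcs simp: arc_to_ends_def)
    show "head G ` out_arcs G i = {j. i \<rightarrow>\<^bsub>G\<^esub> j}"
      by (force simp: arcs_ends_conv)
  qed
  then show ?thesis unfolding out_degree_def by (rule bij_betw_same_card)
qed

lemma laplacian_mult_nth:
  fixes G :: "('n::finite, 'e) pre_digraph"
  assumes "graph G"
  shows "(laplacian G *v v) $ i = (\<Sum>j | i \<rightarrow>\<^bsub>G\<^esub> j. v $ i - v $ j)"
proof -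
  interpret graph G by fact
  have "\<not> i \<rightarrow>\<^bsub>G\<^esub> i" using adj_not_same by blast
  then have "(laplacian G *v v) $ i
      = (\<Sum>j\<in>UNIV. (if i = j then real (out_degree G i) * v $ j else 0)
           - (if i \<rightarrow>\<^bsub>G\<^esub> j then v $ j else 0))"
    unfolding matrix_vector_mult_def laplacian_def by (auto intro!: sum.cong)
  also have "\<dots> = real (out_degree G i) * v $ i - (\<Sum>j | i \<rightarrow>\<^bsub>G\<^esub> j. v $ j)"
    by (simp add: sum_subtractf sum.If_cases)
  also have "\<dots> = (\<Sum>j | i \<rightarrow>\<^bsub>G\<^esub> j. v $ i - v $ j)"
    by (simp add: sum_subtractf out_degree_eq_card[OF assms])
  finally show ?thesis .
qed

lemma transpose_laplacian:
  assumes "graph G"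
  shows "transpose (laplacian G) = laplacian G"
proof -
  interpret graph G by fact
  show ?thesis
    using graph_symmetric by (auto simp: transpose_def laplacian_def vec_eq_iff)
qed

text \<open>Swapping the two summations and using symmetry of adjacency turns the summand
  \<open>v $ i * (v $ i - v $ j)\<close> into \<open>v $ j * (v $ j - v $ i)\<close>; the two add up
  to a square. The factor 2 arises because each edge is counted in both directions.\<close>

lemma laplacian_quadratic_form:
  fixes G :: "('n::finite, 'e) pre_digraph"
  assumes "graph G"
  shows "2 * (v \<bullet> (laplacian G *v v)) = (\<Sum>i\<in>UNIV. \<Sum>j | i \<rightarrow>\<^bsub>G\<^esub> j. (v $ i - v $ j)\<^sup>2)"
proof -
  interpret graph G by fact
  have sym: "i \<rightarrow>\<^bsub>G\<^esub> j \<longleftrightarrow> j \<rightarrow>\<^bsub>G\<^esub> i" for i j using graph_symmetric by blast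
  let ?g = "\<lambda>i j. if i \<rightarrow>\<^bsub>G\<^esub> j then v $ i * (v $ i - v $ j) else 0"
  let ?h = "\<lambda>i j. if i \<rightarrow>\<^bsub>G\<^esub> j then v $ j * (v $ j - v $ i) else 0"
  have 1: "v \<bullet> (laplacian G *v v) = (\<Sum>i\<in>UNIV. \<Sum>j\<in>UNIV. ?g i j)"
    unfolding inner_vec_def by (simp add: laplacian_mult_nth[OF assms] sum_distrib_left sum.If_cases)
  also have "\<dots> = (\<Sum>j\<in>UNIV. \<Sum>i\<in>UNIV. ?g i j)" by (rule sum.swap)
  also have "\<dots> = (\<Sum>i\<in>UNIV. \<Sum>j\<in>UNIV. ?h i j)" using sym by (auto intro!: sum.cong)
  finally have 2: "v \<bullet> (laplacian G *v v) = (\<Sum>i\<in>UNIV. \<Sum>j\<in>UNIV. ?h i j)" .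
  have "2 * (v \<bullet> (laplacian G *v v)) = (\<Sum>i\<in>UNIV. \<Sum>j\<in>UNIV. ?g i j + ?h i j)"
    using 1 2 by (simp add: sum.distrib)
  also have "\<dots> = (\<Sum>i\<in>UNIV. \<Sum>j\<in>UNIV. if i \<rightarrow>\<^bsub>G\<^esub> j then (v $ i - v $ j)\<^sup>2 else 0)"
    by (auto intro!: sum.cong simp: power2_eq_square algebra_simps)
  finally show ?thesis by (simp add: sum.If_cases)
qed

lemma laplacian_nonneg:
  fixes G :: "('n::finite, 'e) pre_digraph"
  assumes "graph G"
  shows "0 \<le> v \<bullet> (laplacian G *v v)"
proof -
  have "0 \<le> 2 * (v \<bullet> (laplacian G *v v))"
    unfolding laplacian_quadratic_form[OF assms] by (intro sum_nonneg) auto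
  then show ?thesis by simp
qed

text \<open>The quadratic form vanishes at \<open>v\<close>, so every square in it is zero:
  \<open>v\<close> agrees across each arc, and connectedness carries the equality along
  paths.\<close>

lemma laplacian_kernel:
  fixes G :: "('n::finite, 'e) pre_digraph"
  assumes G: "graph G" and "verts G = UNIV" and "Digraph_Component.connected G"
    and "laplacian G *v v = 0"
  shows "v $ i = v $ j"
proof -
  interpret graph G by fact
  have "(\<Sum>i\<in>UNIV. \<Sum>j | i \<rightarrow>\<^bsub>G\<^esub> j. (v $ i - v $ j)\<^sup>2) = 0"
    using laplacian_quadratic_form[OF G, of v] assms(4) by simp
  then have "\<forall>i. (\<Sum>j | i \<rightarrow>\<^bsub>G\<^esub> j. (v $ i - v $ j)\<^sup>2) = 0"
    by (subst (asm) sum_nonneg_eq_0_iff) (auto intro: sum_nonneg)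
  then have eq: "v $ i = v $ j" if "i \<rightarrow>\<^bsub>G\<^esub> j" for i j
    using that by (subst (asm) sum_nonneg_eq_0_iff) auto
  have "Digraph_Component.strongly_connected G"
    using symmetric_connected_imp_strongly_connected sym_arcs assms(3) by blast
  then have "i \<rightarrow>\<^sup>*\<^bsub>G\<^esub> j"
    using assms(2) by (simp add: Digraph_Component.strongly_connected_def)
  then show ?thesis
    by (induct rule: reachable_induct) (auto dest: eq)
qed

section \<open>The pseudo-inverse of the Laplacian, via the orthogonal projection onto constant
  vectors\<close>

definition mean_matrix :: "real ^ 'n::finite ^ 'n" where
  "mean_matrix = (\<chi> i j. 1 / real CARD('n))"

lemma mean_matrix_mult_nth: "(mean_matrix *v v) $ i = (\<Sum>j\<in>UNIV. v $ j) / real CARD('n)"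
  for v :: "real ^ 'n::finite"
  by (simp add: mean_matrix_def matrix_vector_mult_def sum_divide_distrib)

lemma transpose_mean_matrix: "transpose mean_matrix = mean_matrix"
  by (simp add: mean_matrix_def transpose_def vec_eq_iff)

lemma mean_matrix_idem: "mean_matrix ** mean_matrix = (mean_matrix :: real ^ 'n::finite ^ 'n)"
  by (simp add: mean_matrix_def matrix_matrix_mult_def vec_eq_iff)

lemma laplacian_mult_mean_matrix:
  fixes G :: "('n::finite, 'e) pre_digraph"
  assumes "graph G"
  shows "laplacian G ** mean_matrix = 0"
  unfolding matrix_eq
proof
  fix v
  show "(laplacian G ** mean_matrix) *v v = 0 *v v"
    by (simp add: vec_eq_iff laplacian_mult_nth[OF assms] mean_matrix_mult_nth
        flip: matrix_vector_mul_assoc)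
qed

lemma mean_matrix_mult_laplacian:
  fixes G :: "('n::finite, 'e) pre_digraph"
  assumes "graph G"
  shows "mean_matrix ** laplacian G = 0"
proof -
  have "mean_matrix ** laplacian G = transpose (laplacian G ** mean_matrix)"
    by (simp add: matrix_transpose_mul transpose_mean_matrix transpose_laplacian[OF assms])
  then show ?thesis
    by (simp add: laplacian_mult_mean_matrix[OF assms] transpose_def vec_eq_iff)
qed

lemma matrix_add_rdistrib: "(A + B) ** C = A ** C + B ** C"
  by (simp add: matrix_matrix_mult_def vec_eq_iff distrib_right sum.distrib)

lemma matrix_diff_ldistrib: "A ** (B - C) = A ** B - A ** C"
  for A :: "'a::ring_1 ^ 'n ^ 'm"
  by (simp add: matrix_matrix_mult_def vec_eq_iff right_diff_distrib sum_subtractf)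

lemma matrix_diff_rdistrib: "(A - B) ** C = A ** C - B ** C"
  for A :: "'a::ring_1 ^ 'n ^ 'm"
  by (simp add: matrix_matrix_mult_def vec_eq_iff left_diff_distrib sum_subtractf)

lemma is_pinv_laplacian:
  fixes G :: "('n::finite, 'e) pre_digraph"
  assumes G: "graph G" "verts G = UNIV" "Digraph_Component.connected G"
  obtains X where "is_pinv (laplacian G) X" "X ** laplacian G = mat 1 - mean_matrix"
proof -
  let ?L = "laplacian G" and ?P = "mean_matrix :: real ^ 'n ^ 'n"
  let ?M = "?L + ?P"
  note LP = laplacian_mult_mean_matrix[OF G(1)] and PL = mean_matrix_mult_laplacian[OF G(1)]
  \<comment> \<open>Applying \<open>?P\<close> kills the \<open>?L\<close> part, so
    \<open>?P *v v = 0\<close> and then \<open>?L *v v = 0\<close>: \<open>v\<close> is constant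
    with mean zero.\<close>
  have "v = 0" if Mv: "?M *v v = 0" for v
  proof -
    have "?P *v (?M *v v) = ?P *v v"
      by (simp add: matrix_vector_mul_assoc matrix_add_ldistrib PL mean_matrix_idem)
    then have Pv: "?P *v v = 0" using Mv by simp
    with Mv have Lv: "?L *v v = 0" by (simp add: matrix_vector_mult_add_rdistrib)
    show "v = 0"
      unfolding vec_eq_iff
    proof
      fix i
      have "(\<Sum>j\<in>UNIV. v $ j) = (\<Sum>j\<in>(UNIV :: 'n set). v $ i)"
        using laplacian_kernel[OF G Lv] by (intro sum.cong) auto
      then show "v $ i = 0 $ i"
        using mean_matrix_mult_nth[of v i] Pv by simp
    qed
  qed
  then obtain M' where M'M: "M' ** ?M = mat 1"
    using matrix_left_invertible_ker[of ?M] by blast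
  then have MM': "?M ** M' = mat 1" by (simp add: matrix_left_right_inverse)
  \<comment> \<open>Since \<open>?M ** ?P = ?P\<close>, the inverse of \<open>?M\<close> fixes
    \<open>?P\<close> as well; the same holds on the other side.\<close>
  have "?P = M' ** ?M ** ?P" using M'M by simp
  then have M'P: "M' ** ?P = ?P"
    by (simp add: LP mean_matrix_idem matrix_add_rdistrib flip: matrix_mul_assoc)
  have "?P = ?P ** (?M ** M')" using MM' by simp
  then have PM': "?P ** M' = ?P"
    by (simp add: PL mean_matrix_idem matrix_add_ldistrib matrix_mul_assoc)
  let ?X = "M' - ?P"
  \<comment> \<open>The term \<open>?P ** ?L\<close> vanishes, and \<open>?L\<close> is written as
    \<open>?M - ?P\<close> so that \<open>M'\<close> can cancel \<open>?M\<close>.\<close>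
  have "?X ** ?L = M' ** (?M - ?P)"
    by (simp add: matrix_diff_rdistrib PL)
  also have "\<dots> = mat 1 - ?P" by (simp only: matrix_diff_ldistrib M'M M'P)
  finally have XL: "?X ** ?L = mat 1 - ?P" .
  have "?L ** ?X = (?M - ?P) ** M'"
    by (simp add: matrix_diff_ldistrib LP)
  also have "\<dots> = mat 1 - ?P" by (simp only: matrix_diff_rdistrib MM' PM')
  finally have LX: "?L ** ?X = mat 1 - ?P" .
  have "transpose (mat 1 - ?P) = mat 1 - ?P"
    by (auto simp: transpose_def vec_eq_iff mat_def mean_matrix_def)
  then have "is_pinv ?L ?X"
    unfolding is_pinv_def LX XL
    by (simp add: matrix_diff_rdistrib matrix_diff_ldistrib PL PM' mean_matrix_idem)
  with XL show thesis using that by blast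
qed

section \<open>Symmetry and positivity of the pseudo-inverse\<close>

lemma is_pinv_transpose:
  assumes "is_pinv A X"
  shows "is_pinv (transpose A) (transpose X)"
proof -
  have "A ** X ** A = A" "X ** A ** X = X"
    "transpose (A ** X) = A ** X" "transpose (X ** A) = X ** A"
    using assms by (auto simp: is_pinv_def)
  then show ?thesis
    unfolding is_pinv_def by (metis matrix_mul_assoc matrix_transpose_mul transpose_transpose)
qed

text \<open>The transpose of \<open>X\<close> is also a pseudo-inverse of \<open>A\<close>, so
  uniqueness applies.\<close>

lemma transpose_is_pinv:
  fixes A :: "real ^ 'n ^ 'n"
  assumes "is_pinv A X" and "transpose A = A"
  shows "transpose X = X"
  using is_pinv_transpose[OF assms(1)] assms by (metis is_pinv_unique)

text \<open>As \<open>X = X A X\<close> with \<open>X\<close> symmetric, the form of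
  \<open>X\<close> at \<open>v\<close> is the form of \<open>A\<close> at
  \<open>X *v v\<close>.\<close>

lemma is_pinv_nonneg:
  fixes A :: "real ^ 'n ^ 'n"
  assumes X: "is_pinv A X" and A: "transpose A = A" and "\<And>v. 0 \<le> v \<bullet> (A *v v)"
  shows "0 \<le> v \<bullet> (X *v v)"
proof -
  have "X *v v = X *v (A *v (X *v v))"
    using X by (simp add: is_pinv_def matrix_vector_mul_assoc matrix_mul_assoc)
  then have "v \<bullet> (X *v v) = (X *v v) \<bullet> (A *v (X *v v))"
    using transpose_is_pinv[OF X A]
    by (metis dot_lmul_matrix vector_transpose_matrix)
  then show ?thesis using assms(3) by simp
qed

text \<open>Positivity at the sum and at the difference of two basis vectors bounds the entry from
  below and from above.\<close>

lemma abs_entry_le_diag_mean: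
  fixes X :: "real ^ 'n ^ 'n"
  assumes sym: "transpose X = X" and pos: "\<And>v. 0 \<le> v \<bullet> (X *v v)"
  shows "\<bar>X $ i $ j\<bar> \<le> (X $ i $ i + X $ j $ j) / 2"
proof -
  have ent: "axis i 1 \<bullet> (X *v axis j 1) = X $ i $ j" for i j
    by (simp add: inner_axis' matrix_vector_mul_component inner_axis)
  have "X $ j $ i = X $ i $ j" using sym by (metis transpose_def vec_lambda_beta)
  then show ?thesis
    using pos[of "axis i 1 + axis j 1"] pos[of "axis i 1 - axis j 1"]
    by (simp add: inner_add_left inner_add_right inner_diff_left inner_diff_right
        matrix_vector_right_distrib matrix_vector_mult_diff_distrib ent)
qed

section \<open>Firings as subtraction of Laplacian columns\<close>

lemma fire_eq_laplacian:
  fixes G :: "('n::finite, 'e) pre_digraph"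
  assumes "graph G" and "can_fire G a i"
  shows "(\<chi> j. real (fire G i a j)) = (\<chi> j. real (a j)) - laplacian G *v axis i 1"
proof -
  interpret graph G by fact
  \<comment> \<open>Firing follows arcs out of \<open>i\<close>, whereas column \<open>i\<close> of
    the Laplacian records arcs into \<open>i\<close>. Legality makes the truncated subtraction in
    \<open>fire\<close> exact.\<close>
  have "i \<rightarrow>\<^bsub>G\<^esub> j \<longleftrightarrow> j \<rightarrow>\<^bsub>G\<^esub> i" for j using graph_symmetric by blast
  then show ?thesis
    using assms(2)
    by (auto simp: vec_eq_iff fire_def can_fire_def laplacian_def matrix_vector_mul_component
        inner_axis of_nat_diff)
qed

lemma game_eq_laplacian:
  fixes G :: "('n::finite, 'e) pre_digraph"
  assumes "game G a vs b" and "graph G"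
  shows "(\<chi> j. real (b j)) = (\<chi> j. real (a j)) - laplacian G *v (\<chi> j. real (count_list vs j))"
  using assms(1)
proof induction
  case (Nil a)
  show ?case by (simp add: vec_eq_iff laplacian_mult_nth[OF assms(2)])
next
  case (Cons a i vs b)
  have "(\<chi> j. real (count_list (i # vs) j)) = axis i 1 + (\<chi> j. real (count_list vs j))"
    by (auto simp: vec_eq_iff axis_def)
  then show ?case
    by (simp only: Cons.IH fire_eq_laplacian[OF assms(2) Cons.hyps(1)]
        matrix_vector_right_distrib) simp
qed

section \<open>The bound on the number of firings\<close>

theorem mainTheorem2:
  fixes G :: "('n::finite, 'e) pre_digraph"
    and a b :: "'n config" and vs :: "'n list" and x :: "'n \<Rightarrow> nat" and k :: 'n
    and n N s \<Delta> :: nat and L' :: "real ^ 'n ^ 'n" and f off :: real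
  assumes "graph G" and "verts G = UNIV" and "Digraph_Component.connected G"
    and "n = CARD('n)" and "\<Delta> = max_degree G"
    and "terminating_game G a vs b"
    and "N = (\<Sum>i\<in>UNIV. a i)"
    and "\<And>i. x i = count_list vs i"
    and "s = (\<Sum>i\<in>UNIV. x i)"
    and "x k = 0"
    and "L' = pinv (laplacian G)"
    and "f = Max {L' $ i $ i | i. True}"
    and "off = Max {\<bar>L' $ i $ j\<bar> | i j. i \<noteq> j}"
  shows "real s \<le> real n * (f * (real \<Delta> - 1) + off * (2 * real N - real \<Delta> + 1))"
proof -
  interpret graph G by fact
  let ?L = "laplacian G"
  let ?a = "\<chi> i. real (a i)" and ?b = "\<chi> i. real (b i)" and ?x = "\<chi> i. real (x i)"
  obtain X where X: "is_pinv ?L X" and XL: "X ** ?L = mat 1 - mean_matrix"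
    using is_pinv_laplacian[OF assms(1-3)] by blast
  have L': "L' = X" using X assms(11) pinv_eqI by blast
  have game: "game G a vs b" and stuck: "\<not> can_fire G b i" for i
    using assms(6) by (auto simp: terminating_game_def)
  have b: "?b = ?a - ?L *v ?x"
    using game_eq_laplacian[OF game assms(1)] by (simp add: assms(8))

  \<comment> \<open>Chips are conserved: \<open>mean_matrix\<close> annihilates the Laplacian, so
    \<open>a\<close> and \<open>b\<close> have the same mean.\<close>
  have "mean_matrix *v ?b = mean_matrix *v ?a"
    by (simp add: b matrix_vector_mult_diff_distrib matrix_vector_mul_assoc
        mean_matrix_mult_laplacian[OF assms(1)])
  then have "(\<Sum>i\<in>UNIV. real (b i)) = (\<Sum>i\<in>UNIV. real (a i))"
    using mean_matrix_mult_nth[of ?a k] mean_matrix_mult_nth[of ?b k] by simp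
  then have sum_b: "(\<Sum>i\<in>UNIV. real (b i)) = real N" and sum_a: "(\<Sum>i\<in>UNIV. real (a i)) = real N"
    by (simp_all add: assms(7))

  have "X *v (?b - ?a) = mean_matrix *v ?x - ?x"
  proof -
    have "X *v (?b - ?a) = - ((X ** ?L) *v ?x)"
      by (simp add: b matrix_vector_mul_assoc linear_neg)
    then show ?thesis by (simp add: XL matrix_vector_mult_diff_rdistrib)
  qed
  then have "(X *v (?b - ?a)) $ k = real s / real n"
    using assms(4,9,10) by (simp add: mean_matrix_mult_nth)
  then have s: "real s = real n * (\<Sum>j\<in>UNIV. X $ k $ j * (real (b j) - real (a j)))"
    using assms(4) by (simp add: matrix_vector_mult_def)

  \<comment> \<open>No vertex can fire at the end, so the inequality is strict; this is the source
    of the \<open>- 1\<close> in \<open>real \<Delta> - 1\<close>.\<close>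
  have lt: "b i < out_degree G i" for i
    using stuck[of i] assms(2) by (auto simp: can_fire_def)
  have "out_degree G k \<le> \<Delta>"
    unfolding assms(5) max_degree_def using assms(2) by (intro Max_ge) auto
  with lt[of k] have bk: "real (b k) \<le> real \<Delta> - 1" by linarith
  \<comment> \<open>A vertex of degree 0 can always fire, so there is a second vertex and \<open>off\<close> is not the
    unspecified maximum of the empty set.\<close>
  have "{j. k \<rightarrow>\<^bsub>G\<^esub> j} \<noteq> {}"
    using lt[of k] out_degree_eq_card[OF assms(1), of k] by force
  then obtain l where "k \<rightarrow>\<^bsub>G\<^esub> l" by blast
  then have l: "k \<noteq> l" using adj_not_same by metis

  have f: "X $ i $ i \<le> f" for i
    unfolding assms(12) L' by (intro Max_ge) (auto simp: full_SetCompr_eq)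
  have fin: "finite {\<bar>L' $ i $ j\<bar> | i j. i \<noteq> j}"
    by (rule finite_subset[of _ "(\<lambda>(i, j). \<bar>L' $ i $ j\<bar>) ` UNIV"]) auto
  have off: "\<bar>X $ i $ j\<bar> \<le> off" if "i \<noteq> j" for i j
    unfolding assms(13) using fin that by (intro Max_ge) (auto simp: L')
  have off_nonneg: "0 \<le> off" using off[OF l] by linarith
  \<comment> \<open>Each entry is dominated by the mean of two diagonal entries, both at most
    \<open>f\<close>.\<close>
  have "\<bar>X $ i $ j\<bar> \<le> f" for i j
    using abs_entry_le_diag_mean[OF transpose_is_pinv is_pinv_nonneg, OF X _ X, of i j]
      transpose_laplacian[OF assms(1)] laplacian_nonneg[OF assms(1)] f[of i] f[of j] by simp
  then have off_le_f: "off \<le> f"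
    unfolding assms(13) using fin l by (subst Max_le_iff) (auto simp: L')

  \<comment> \<open>A nonnegative diagonal entry allows the contribution of \<open>a k\<close> to be
    dropped.\<close>
  have diag: "X $ k $ k * (real (b k) - real (a k)) \<le> f * real (b k)"
  proof -
    have "0 \<le> X $ k $ k"
      using is_pinv_nonneg[OF X, of "axis k 1"] transpose_laplacian[OF assms(1)]
        laplacian_nonneg[OF assms(1)]
      by (simp add: inner_axis' matrix_vector_mul_component inner_axis)
    then have "X $ k $ k * (real (b k) - real (a k)) \<le> X $ k $ k * real (b k)"
      by (intro mult_left_mono) auto
    also have "\<dots> \<le> f * real (b k)" by (intro mult_right_mono f) auto
    finally show ?thesis .
  qed
  have "X $ k $ j * (real (b j) - real (a j)) \<le> off * (real (b j) + real (a j))"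
    if "j \<noteq> k" for j
  proof -
    have "X $ k $ j * (real (b j) - real (a j)) \<le> \<bar>X $ k $ j\<bar> * \<bar>real (b j) - real (a j)\<bar>"
      by (metis abs_ge_self abs_mult)
    \<comment> \<open>Chip counts are nonnegative, so the distance of \<open>b j\<close> and
      \<open>a j\<close> is at most their sum.\<close>
    also have "\<dots> \<le> off * (real (b j) + real (a j))"
      using off[of k j] off_nonneg that by (intro mult_mono) auto
    finally show ?thesis .
  qed
  then have "(\<Sum>j\<in>UNIV - {k}. X $ k $ j * (real (b j) - real (a j)))
      \<le> (\<Sum>j\<in>UNIV - {k}. off * (real (b j) + real (a j)))"
    by (intro sum_mono) auto
  \<comment> \<open>Each configuration has \<open>N\<close> chips, and the sum leaves out those on
    \<open>k\<close>.\<close>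
  also have "\<dots> = off * (2 * real N - real (b k) - real (a k))"
    by (simp add: sum_b sum_a sum_diff1 sum.distrib flip: sum_distrib_left)
  also have "\<dots> \<le> off * (2 * real N - real (b k))"
    using off_nonneg by (intro mult_left_mono) auto
  finally have "(\<Sum>j\<in>UNIV. X $ k $ j * (real (b j) - real (a j)))
      \<le> f * real (b k) + off * (2 * real N - real (b k))"
    using diag by (simp add: sum.remove[of UNIV k])
  \<comment> \<open>Collecting the terms in \<open>b k\<close> exposes the coefficient
    \<open>f - off\<close>, whose nonnegativity makes the bound monotone in
    \<open>b k\<close>.\<close>
  also have "\<dots> = (f - off) * real (b k) + off * (2 * real N)" by (simp add: algebra_simps)
  also have "\<dots> \<le> (f - off) * (real \<Delta> - 1) + off * (2 * real N)"
    using off_le_f bk by (intro add_right_mono mult_left_mono) auto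
  also have "\<dots> = f * (real \<Delta> - 1) + off * (2 * real N - real \<Delta> + 1)"
    by (simp add: algebra_simps)
  finally show ?thesis unfolding s by (intro mult_left_mono) auto
qed

end
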